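(* Let $A,B,\Omega\in\mathbb{R}^{n\times n}$ and $c\in\mathbb{R}^n$, and let $A=\bar M-\bar N$ with $\bar M,\bar N\in\mathbb{R}^{n\times n}$. If $\bar M+\Omega$ is nonsingular and $$\|(\bar M+\Omega)^{-1}(\bar N+\Omega)\|+\|(\bar M+\Omega)^{-1}B\|<1,$$ then the system $Ax-B|x|-c=0$ has a unique solution $x^*\in\mathbb{R}^n$, and for every initial vector $x^0\in\mathbb{R}^n$ the Newton-based matrix splitting iteration $$x^{k+1}=(\bar M+\Omega)^{-1}\left[(\bar N+\Omega)x^k+B|x^k|+c\right],\qquad k=0,1,2,\dots,$$ converges linearly to $x^*$.
   Context: For $x\in\mathbb{R}^n$, $|x|=(|x_1|,\dots,|x_n|)^\top$ is the componentwise absolute value. $\|\cdot\|$ denotes the Euclidean norm of vectors and the induced $2$-norm (spectral norm) of matrices. A sequence $\{x^k\}$ converges linearly to $x^*$ if there is a constant $q\in[0,1)$ such that $\|x^{k+1}-x^*\|\le q\,\|x^k-x^*\|$ for all $k\ge 0$. *)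

theory Defs
  imports "HOL-Analysis.Analysis"
begin

text \<open>
  The library's \<open>norm\<close> on the type of matrices is the Frobenius norm, so the spectral norm has to be
  introduced as the operator norm induced by the Euclidean norm.
\<close>

definition spectral_norm :: "real^'n^'m \<Rightarrow> real" where
  "spectral_norm A = onorm (\<lambda>x. A *v x)"

definition converges_linearly :: "(nat \<Rightarrow> 'a::real_normed_vector) \<Rightarrow> 'a \<Rightarrow> bool" where
  "converges_linearly x l \<longleftrightarrow>
     (\<exists>q. 0 \<le> q \<and> q < 1 \<and> (\<forall>k. norm (x (Suc k) - l) \<le> q * norm (x k - l)))"

text \<open>On vectors, the library's \<open>\<bar>x\<bar>\<close> is the componentwise absolute value.\<close>

primrec nms_iteration ::
  "real^'n^'n \<Rightarrow> real^'n^'n \<Rightarrow> real^'n^'n \<Rightarrow> real^'n^'n \<Rightarrow> real^'n \<Rightarrow> real^'n \<Rightarrow> nat \<Rightarrow> real^'n"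
where
  "nms_iteration M N \<Omega> B c x0 0 = x0"
| "nms_iteration M N \<Omega> B c x0 (Suc k) =
     matrix_inv (M + \<Omega>) *v
       ((N + \<Omega>) *v nms_iteration M N \<Omega> B c x0 k + B *v \<bar>nms_iteration M N \<Omega> B c x0 k\<bar> + c)"

end

theory Submission
  imports Defs
begin

text \<open>
  Multiplying by \<open>(M + \<Omega>)\<inverse>\<close> turns the equation into the fixed point equation of the iteration map.
  Since the componentwise absolute value is nonexpansive, that map is a contraction whose constant
  is the given sum of spectral norms, and Banach's fixed point theorem applies.
\<close>

text \<open>The reverse triangle inequality holds in each component, and the Euclidean norm is
  monotone in the moduli of the components.\<close>

lemma norm_abs_diff_le:
  fixes x y :: "real^'n"
  shows "norm (\<bar>x\<bar> - \<bar>y\<bar>) \<le> norm (x - y)"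
  by (rule norm_le_componentwise_cart) (simp add: abs_vec_def abs_triangle_ineq3)

lemma norm_matrix_vector_mult_le:
  "norm (A *v x) \<le> spectral_norm A * norm x"
  unfolding spectral_norm_def by (rule onorm) simp

lemma spectral_norm_nonneg: "0 \<le> spectral_norm A"
  unfolding spectral_norm_def by (rule onorm_pos_le) simp

text \<open>Lets the inverse be moved across an equation, which links fixed points of the iteration
  map to solutions of the system.\<close>

lemma matrix_inv_eq_iff:
  fixes P :: "real^'n^'n"
  assumes "invertible P"
  shows "matrix_inv P *v z = x \<longleftrightarrow> P *v x = z"
proof -
  \<comment> \<open>\<open>matrix_inv\<close> is a choice; invertibility provides a witness, so the
    chosen matrix is a two-sided inverse.\<close>
  have "P ** matrix_inv P = mat 1 \<and> matrix_inv P ** P = mat 1"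
    using assms unfolding invertible_def matrix_inv_def by (rule someI_ex)
  then show ?thesis
    by (metis matrix_vector_mul_assoc matrix_vector_mul_lid)
qed

theorem corollary3p4:
  fixes A B \<Omega> M N :: "real^'n^'n" and c :: "real^'n"
  assumes "A = M - N"
    and "invertible (M + \<Omega>)"
    and "spectral_norm (matrix_inv (M + \<Omega>) ** (N + \<Omega>)) + spectral_norm (matrix_inv (M + \<Omega>) ** B) < 1"
  shows "\<exists>xs :: real^'n.
           A *v xs - B *v \<bar>xs\<bar> - c = 0 \<and>
           (\<forall>y. A *v y - B *v \<bar>y\<bar> - c = 0 \<longrightarrow> y = xs) \<and>
           (\<forall>x0. converges_linearly (nms_iteration M N \<Omega> B c x0) xs)"
proof -
  define P where "P = matrix_inv (M + \<Omega>)"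
  define f where "f x = P *v ((N + \<Omega>) *v x + B *v \<bar>x\<bar> + c)" for x
  define q where "q = spectral_norm (P ** (N + \<Omega>)) + spectral_norm (P ** B)"
  have q: "0 \<le> q" "q < 1"
    using assms(3) by (simp_all add: q_def P_def spectral_norm_nonneg)
  have contraction: "norm (f x - f y) \<le> q * norm (x - y)" for x y
  proof -
    \<comment> \<open>The constant \<open>c\<close> cancels in the difference.\<close>
    have "f x - f y = (P ** (N + \<Omega>)) *v (x - y) + (P ** B) *v (\<bar>x\<bar> - \<bar>y\<bar>)"
      by (simp add: f_def matrix_vector_mult_diff_distrib matrix_vector_right_distrib
          flip: matrix_vector_mul_assoc)
    also have "norm \<dots> \<le> norm ((P ** (N + \<Omega>)) *v (x - y)) + norm ((P ** B) *v (\<bar>x\<bar> - \<bar>y\<bar>))"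
      by (rule norm_triangle_ineq)
    also have "\<dots> \<le> spectral_norm (P ** (N + \<Omega>)) * norm (x - y)
        + spectral_norm (P ** B) * norm (\<bar>x\<bar> - \<bar>y\<bar>)"
      by (intro add_mono norm_matrix_vector_mult_le)
    \<comment> \<open>Nonexpansiveness of the absolute value turns both terms into multiples of
      \<open>norm (x - y)\<close>.\<close>
    also have "\<dots> \<le> q * norm (x - y)"
      by (simp add: q_def distrib_right mult_left_mono norm_abs_diff_le spectral_norm_nonneg)
    finally show ?thesis .
  qed
  \<comment> \<open>With the inverse moved across, the equation reads \<open>(M + \<Omega>) *v x =
    (N + \<Omega>) *v x + B *v \<bar>x\<bar> + c\<close>; the \<open>\<Omega>\<close> terms cancel
    and \<open>M - N\<close> is \<open>A\<close>.\<close>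
  have fixed_iff: "f x = x \<longleftrightarrow> A *v x - B *v \<bar>x\<bar> - c = 0" for x
    unfolding f_def P_def matrix_inv_eq_iff[OF assms(2)]
    by (auto simp: assms(1) matrix_vector_mult_add_rdistrib matrix_vector_mult_diff_rdistrib
        algebra_simps)
  have "\<exists>!x. f x = x"
    using q contraction by (intro banach_fix_type[of q]) (auto simp: dist_norm)
  then obtain xs where xs: "f xs = xs" and unique: "\<And>y. f y = y \<Longrightarrow> y = xs"
    by blast
  have "converges_linearly (nms_iteration M N \<Omega> B c x0) xs" for x0
  proof -
    have "nms_iteration M N \<Omega> B c x0 (Suc k) = f (nms_iteration M N \<Omega> B c x0 k)" for k
      by (simp add: f_def P_def)
    \<comment> \<open>Comparing each iterate with the fixed point \<open>xs\<close> makes the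
      contraction constant \<open>q\<close> the linear rate, for every starting vector.\<close>
    then show ?thesis
      unfolding converges_linearly_def using q contraction[of _ xs] xs by (intro exI[of _ q]) auto
  qed
  with xs unique show ?thesis
    unfolding fixed_iff by blast
qed

end
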